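(* Let $D$ be a strongly connected balanced bipartite digraph of order $2a$, where $a\geq 2$. Suppose that for every dominating pair $\{u,v\}$ of vertices in $D$, \[ d(u)+d(v)\geq 3a+1. \] Then $D$ is hamiltonian.
   Context: Digraphs have no loops and no multiple arcs. For a vertex $v$, $d(v)=d^+(v)+d^-(v)$ is the sum of its out-degree and in-degree. A pair of distinct vertices $\{u,v\}$ is dominating if there is a vertex $w$ with $uw$ and $vw$ both arcs of $D$. A balanced bipartite digraph has two partite sets of equal size. Hamiltonian means containing a directed cycle through all vertices. *)

theory Defs
  imports "Graph_Theory.Graph_Theory"
begin

text \<open>
  The locale predicate \<open>digraph\<close> covers finite digraphs without loops and
  without parallel arcs.
\<close>

definition degree :: "('a, 'b) pre_digraph \<Rightarrow> 'a \<Rightarrow> nat" where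
  "degree G v = out_degree G v + in_degree G v"

definition dominating_pair :: "('a, 'b) pre_digraph \<Rightarrow> 'a \<Rightarrow> 'a \<Rightarrow> bool" where
  "dominating_pair G u v \<longleftrightarrow>
     u \<noteq> v \<and> (\<exists>w \<in> verts G. u \<rightarrow>\<^bsub>G\<^esub> w \<and> v \<rightarrow>\<^bsub>G\<^esub> w)"

definition bipartition :: "('a, 'b) pre_digraph \<Rightarrow> 'a set \<Rightarrow> 'a set \<Rightarrow> bool" where
  "bipartition G X Y \<longleftrightarrow>
     X \<union> Y = verts G \<and> X \<inter> Y = {} \<and>
     (\<forall>e \<in> arcs G. (tail G e \<in> X \<and> head G e \<in> Y) \<or> (tail G e \<in> Y \<and> head G e \<in> X))"

definition balanced_bipartite :: "('a, 'b) pre_digraph \<Rightarrow> bool" where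
  "balanced_bipartite G \<longleftrightarrow> (\<exists>X Y. bipartition G X Y \<and> card X = card Y)"

text \<open>
  A cycle is a nonempty list \<open>p\<close> of arcs. The vertex argument of \<open>awalk_verts\<close>
  matters only for the empty list, so it plays no role here.
\<close>

definition hamiltonian :: "('a, 'b) pre_digraph \<Rightarrow> bool" where
  "hamiltonian G \<longleftrightarrow>
     (\<exists>u p. pre_digraph.cycle G p \<and> set (pre_digraph.awalk_verts G u p) = verts G)"

end

theory Submission
  imports Defs
begin

text \<open>
  A minimal violator of Hall's condition contradicts the degree condition, so there are
  perfect matchings in both directions between the partite sets. They form a cycle factor,
  encoded as a permutation \<open>s\<close> of the vertices with every \<open>(v, s v)\<close> an arc.
  Take a factor whose orbits are as large as possible. If \<open>v\<close> and \<open>w\<close> lie on different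
  cycles, then \<open>(v, s w)\<close> and \<open>(w, s v)\<close> are not both arcs, for exchanging them with
  \<open>(v, s v)\<close> and \<open>(w, s w)\<close> would merge the two cycles.

  Suppose there are several cycles, and let \<open>C\<close> be one with at most \<open>a\<close> vertices, \<open>m\<close> of
  them in each class. Put \<open>F v = d\<^sup>+ v + d\<^sup>- (s v)\<close>; the sum of \<open>F\<close> over \<open>C\<close> is the
  sum of the degrees over \<open>C\<close>. Vertices outside \<open>C\<close> contribute at most \<open>a - m\<close> to
  \<open>F v\<close>. Inside \<open>C\<close>, two vertices \<open>v\<close> and \<open>w\<close> of the same class contribute to each
  other's \<open>F\<close> only if they form a dominating pair, and then their degrees are large.
  Weighing this pair by pair shows, for \<open>m \<ge> 2\<close>, that the sum of \<open>F\<close> over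
  each class of \<open>C\<close> is smaller than the sum of the degrees, a contradiction. For \<open>m = 1\<close>
  the degrees on \<open>C\<close> are exactly \<open>a + 1\<close>, so dominating partners are joined to everything
  in both directions, and an exchange exists.
\<close>

section \<open>Hall's marriage theorem\<close>

text \<open>Induction on the size of \<open>X\<close>. If a proper nonempty \<open>T\<close> is
  tight, \<open>T\<close> and \<open>X - T\<close> are matched separately. Otherwise every proper
  nonempty subset has a spare neighbour, so any edge at \<open>x\<close> can be fixed first.\<close>

lemma hall_marriage:
  fixes E :: "('a \<times> 'b) set"
  assumes "finite X" and "finite (E `` X)" and "\<And>S. S \<subseteq> X \<Longrightarrow> card S \<le> card (E `` S)"
  shows "\<exists>f. inj_on f X \<and> (\<forall>x\<in>X. (x, f x) \<in> E)"
  using assms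
proof (induction "card X" arbitrary: X E rule: less_induct)
  case less
  have fin: "finite (E `` S)" if "S \<subseteq> X" for S
    using less.prems(2) that by (meson Image_mono finite_subset order_refl)
  show ?case
  proof (cases "X = {}")
    case False
    then obtain x where x: "x \<in> X" by blast
    show ?thesis
    proof (cases "\<exists>T. T \<subset> X \<and> T \<noteq> {} \<and> card (E `` T) = card T")
      case True
      then obtain T where T: "T \<subset> X" "T \<noteq> {}" "card (E `` T) = card T" by blast
      have finT: "finite T" using T less.prems(1) by (meson finite_subset psubset_imp_subset)
      have "card T < card X" using T less.prems(1) by (simp add: psubset_card_mono)
      moreover have "\<exists>f. inj_on f T \<and> (\<forall>x\<in>T. (x, f x) \<in> E)"
        using T less.prems(3) finT fin by (intro less.hyps[OF \<open>card T < card X\<close>]) auto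
      ultimately obtain f where f: "inj_on f T" "\<And>x. x \<in> T \<Longrightarrow> (x, f x) \<in> E" by blast
      define E' where "E' = E - UNIV \<times> (E `` T)"
      have lt: "card (X - T) < card X"
        using T less.prems(1) by (intro psubset_card_mono) auto
      have "\<exists>g. inj_on g (X - T) \<and> (\<forall>x\<in>X - T. (x, g x) \<in> E')"
      proof (rule less.hyps[OF lt])
        show "finite (X - T)" using less.prems(1) by simp
        show "finite (E' `` (X - T))"
          by (rule finite_subset[OF _ less.prems(2)]) (auto simp: E'_def)
        fix S assume S: "S \<subseteq> X - T"
        have "finite S" using S less.prems(1) by (meson Diff_subset finite_subset)
        \<comment> \<open>Subtracting the tight \<open>T\<close> from the condition for
          \<open>S \<union> T\<close> leaves the condition for \<open>S\<close> under
          \<open>E'\<close>.\<close>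
        have "E `` (S \<union> T) = E' `` S \<union> E `` T" by (auto simp: E'_def)
        then have "card (E `` (S \<union> T)) \<le> card (E' `` S) + card T"
          using card_Un_le[of "E' `` S" "E `` T"] T(3) by simp
        moreover have "card (S \<union> T) = card S + card T"
          using S \<open>finite S\<close> finT by (intro card_Un_disjoint) auto
        moreover have "card (S \<union> T) \<le> card (E `` (S \<union> T))"
          using S T by (intro less.prems(3)) auto
        ultimately show "card S \<le> card (E' `` S)" by linarith
      qed
      then obtain g where g: "inj_on g (X - T)" "\<And>x. x \<in> X - T \<Longrightarrow> (x, g x) \<in> E'" by blast
      let ?h = "\<lambda>x. if x \<in> T then f x else g x"
      have "inj_on ?h X"
      proof (rule inj_onI)
        fix x y assume xy: "x \<in> X" "y \<in> X" "?h x = ?h y"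
        have "f u \<noteq> g v" if "u \<in> T" "v \<in> X - T" for u v
          using f(2)[OF that(1)] g(2)[OF that(2)] that by (auto simp: E'_def)
        then show "x = y" using xy f(1) g(1)
          by (cases "x \<in> T"; cases "y \<in> T") (auto dest: inj_onD, metis DiffI)
      qed
      moreover have "\<forall>x\<in>X. (x, ?h x) \<in> E" using f(2) g(2) by (auto simp: E'_def)
      ultimately show ?thesis by (intro exI[of _ ?h]) blast
    next
      case False
      have "card {x} \<le> card (E `` {x})" using x by (intro less.prems(3)) auto
      then obtain y where y: "(x, y) \<in> E" by (cases "E `` {x} = {}") auto
      define E' where "E' = E - UNIV \<times> {y}"
      have lt: "card (X - {x}) < card X"
        using x less.prems(1) by (intro psubset_card_mono) auto
      have "\<exists>g. inj_on g (X - {x}) \<and> (\<forall>x\<in>X - {x}. (x, g x) \<in> E')"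
      proof (rule less.hyps[OF lt])
        show "finite (X - {x})" using less.prems(1) by simp
        show "finite (E' `` (X - {x}))"
          by (rule finite_subset[OF _ less.prems(2)]) (auto simp: E'_def)
        fix S assume S: "S \<subseteq> X - {x}"
        show "card S \<le> card (E' `` S)"
        proof (cases "S = {}")
          case nonempty: False
          have "S \<subset> X" using S x by auto
          then have "card S \<noteq> card (E `` S)" using nonempty False by metis
          moreover have "card S \<le> card (E `` S)" using \<open>S \<subset> X\<close> by (intro less.prems(3)) auto
          moreover have "E' `` S = E `` S - {y}" by (auto simp: E'_def)
          ultimately show ?thesis using fin[of S] \<open>S \<subset> X\<close>
            by (auto simp: card_Diff_singleton_if)
        qed simp
      qed
      then obtain g where g: "inj_on g (X - {x})" "\<And>u. u \<in> X - {x} \<Longrightarrow> (u, g u) \<in> E'" by blast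
      have "y \<notin> g ` (X - {x})" using g(2) by (auto simp: E'_def)
      then have "inj_on (g(x := y)) (insert x (X - {x}))"
        using g(1) by (subst inj_on_insert) (auto simp: inj_on_def)
      then have "inj_on (g(x := y)) X" using x by (simp add: insert_absorb)
      moreover have "\<forall>u\<in>X. (u, (g(x := y)) u) \<in> E" using g(2) y by (auto simp: E'_def)
      ultimately show ?thesis by blast
    qed
  qed auto
qed

section \<open>Merging two cycles of a permutation\<close>

text \<open>The merged cycle runs from \<open>v\<close> to \<open>s w\<close>, along the old cycle
  to \<open>w\<close>, then to \<open>s v\<close> and along the other old cycle back to
  \<open>v\<close>.\<close>

lemma orbit_merge:
  assumes p: "permutation s" and w: "w \<notin> orbit s v"
    and s': "s' = s(v := s w, w := s v)"
  shows "orbit s u \<subseteq> orbit s' u" and "w \<in> orbit s' v"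
proof -
  have self: "x \<in> orbit s x" for x using p by (rule permutation_self_in_orbit)
  have v: "v \<notin> orbit s w" using w self by (metis orbit_swap)
  have ne: "v \<noteq> w" using w self by blast
  \<comment> \<open>Serves both halves of the merged cycle: \<open>t\<close> jumps from
    \<open>x\<close> to \<open>s y\<close> and then follows \<open>s\<close>. It meets neither
    \<open>x\<close>, which is off this cycle, nor \<open>y\<close> before step \<open>n\<close>,
    the length of the cycle.\<close>
  have go: "y \<in> orbit t x"
    if t: "t x = s y" "\<And>z. z \<noteq> x \<Longrightarrow> z \<noteq> y \<Longrightarrow> t z = s z" and x: "x \<notin> orbit s y" for t x y
  proof -
    define n where "n = funpow_dist1 s y y"
    have n: "(s ^^ n) y = y" unfolding n_def using self by (rule funpow_dist1_prop)
    have "(s ^^ k) y \<in> orbit t x" if "0 < k" "k \<le> n" for k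
      using that
    proof (induction k)
      case (Suc k)
      show ?case
      proof (cases "k = 0")
        case True
        then show ?thesis using orbit.base[of t x] t(1) by simp
      next
        case False
        then have IH: "(s ^^ k) y \<in> orbit t x" using Suc by simp
        have "(s ^^ k) y \<noteq> y"
          using False Suc.prems funpow_dist1_least[of k s y y] unfolding n_def by simp
        moreover have "(s ^^ k) y \<in> orbit s y" using False by (auto simp: orbit_altdef)
        ultimately have "t ((s ^^ k) y) = (s ^^ Suc k) y" using t(2) x by (metis funpow.simps(2) comp_apply)
        then show ?thesis using orbit.step[OF IH] by simp
      qed
    qed simp
    from this[of n] n show ?thesis by (simp add: n_def)
  qed
  show wv: "w \<in> orbit s' v" using v by (intro go) (auto simp: s' ne)
  have vw: "v \<in> orbit s' w" using w by (intro go) (auto simp: s' ne)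
  \<comment> \<open>Each single step of \<open>s\<close> is a walk of \<open>s'\<close>; induction
    along an orbit then gives the inclusion.\<close>
  have "s x \<in> orbit s' x" for x
  proof -
    consider "x = v" | "x = w" | "x \<noteq> v" "x \<noteq> w" by blast
    then show ?thesis
    proof cases
      case 1
      then show ?thesis using orbit.step[OF wv] by (simp add: s')
    next
      case 2
      then show ?thesis using orbit.step[OF vw] by (simp add: s' ne)
    next
      case 3
      then show ?thesis using orbit.base[of s' x] by (simp add: s')
    qed
  qed note step = this
  show "orbit s u \<subseteq> orbit s' u"
  proof
    fix x assume "x \<in> orbit s u"
    then show "x \<in> orbit s' u"
      by induction (use step orbit_trans in fast)+
  qed
qed

section \<open>The degree condition on an adjacency relation\<close>

locale dominating_degree_digraph =
  fixes X Y :: "'a set" and E :: "'a rel" and a :: nat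
  assumes finite_X: "finite X" and finite_Y: "finite Y" and disjoint: "X \<inter> Y = {}"
    and card_X: "card X = a" and card_Y: "card Y = a" and a_ge_2: "a \<ge> 2"
    and bipartite: "E \<subseteq> X \<times> Y \<union> Y \<times> X"
    and strong: "u \<in> X \<union> Y \<Longrightarrow> v \<in> X \<union> Y \<Longrightarrow> (u, v) \<in> E\<^sup>*"
    and degree_sum: "u \<noteq> v \<Longrightarrow> (u, w) \<in> E \<Longrightarrow> (v, w) \<in> E \<Longrightarrow>
      card (E `` {u}) + card (E\<inverse> `` {u}) + (card (E `` {v}) + card (E\<inverse> `` {v})) \<ge> 3 * a + 1"
begin

definition deg :: "'a \<Rightarrow> nat" where
  "deg v = card (E `` {v}) + card (E\<inverse> `` {v})"

definition dom :: "'a \<Rightarrow> 'a \<Rightarrow> bool" where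
  "dom u v \<longleftrightarrow> u \<noteq> v \<and> (\<exists>w. (u, w) \<in> E \<and> (v, w) \<in> E)"

text \<open>The hypotheses are symmetric in \<open>X\<close> and \<open>Y\<close>, so facts proved
  for one side carry over to the other.\<close>

lemma swap_sides: "dominating_degree_digraph Y X E a"
proof
  show "Y \<inter> X = {}" using disjoint by auto
  show "E \<subseteq> Y \<times> X \<union> X \<times> Y" using bipartite by auto
  show "(u, v) \<in> E\<^sup>*" if "u \<in> Y \<union> X" "v \<in> Y \<union> X" for u v
    using strong[of u v] that by blast
qed (fact finite_X finite_Y card_X card_Y a_ge_2 degree_sum)+

lemma domI: "u \<noteq> v \<Longrightarrow> (u, w) \<in> E \<Longrightarrow> (v, w) \<in> E \<Longrightarrow> dom u v"
  by (auto simp: dom_def)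

lemma deg_dom: "dom u v \<Longrightarrow> deg u + deg v \<ge> 3 * a + 1"
  using degree_sum by (auto simp: dom_def deg_def)

lemma Image_in_Y: "S \<subseteq> X \<Longrightarrow> E `` S \<subseteq> Y" "S \<subseteq> X \<Longrightarrow> E\<inverse> `` S \<subseteq> Y"
  using bipartite disjoint by auto

lemma Image_in_X: "S \<subseteq> Y \<Longrightarrow> E `` S \<subseteq> X" "S \<subseteq> Y \<Longrightarrow> E\<inverse> `` S \<subseteq> X"
  using bipartite disjoint by auto

lemma finite_Image: "finite (E `` S)" "finite (E\<inverse> `` S)"
  by (rule finite_subset[of _ "X \<union> Y"]; use bipartite finite_X finite_Y in auto)+

lemma out_le: "card (E `` {v}) \<le> a" and in_le: "card (E\<inverse> `` {v}) \<le> a"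
proof -
  consider "v \<in> X" | "v \<in> Y" | "E `` {v} = {}" "E\<inverse> `` {v} = {}" using bipartite by blast
  then have "card (E `` {v}) \<le> a \<and> card (E\<inverse> `` {v}) \<le> a"
  proof cases
    case 1
    then show ?thesis using Image_in_Y[of "{v}"] card_mono[OF finite_Y] card_Y by auto
  next
    case 2
    then show ?thesis using Image_in_X[of "{v}"] card_mono[OF finite_X] card_X by auto
  qed auto
  then show "card (E `` {v}) \<le> a" "card (E\<inverse> `` {v}) \<le> a" by auto
qed

text \<open>The partner has degree at most \<open>2 * a\<close>, which leaves at least
  \<open>a + 1\<close> of the \<open>3 * a + 1\<close>.\<close>

lemma deg_dom_ge: assumes "dom u v" shows "deg u \<ge> a + 1" "deg v \<ge> a + 1"
  using deg_dom[OF assms] out_le[of u] in_le[of u] out_le[of v] in_le[of v]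
  by (auto simp: deg_def)

lemma closed_out: assumes "E `` Z \<subseteq> Z" "Z \<inter> (X \<union> Y) \<noteq> {}" shows "X \<union> Y \<subseteq> Z"
proof
  fix v assume v: "v \<in> X \<union> Y"
  obtain u where u: "u \<in> Z" "u \<in> X \<union> Y" using assms(2) by blast
  from strong[OF u(2) v] show "v \<in> Z"
    by induction (use u assms(1) in auto)
qed

lemma closed_in: assumes "E\<inverse> `` Z \<subseteq> Z" "Z \<inter> (X \<union> Y) \<noteq> {}" shows "X \<union> Y \<subseteq> Z"
proof
  fix v assume v: "v \<in> X \<union> Y"
  obtain u where u: "u \<in> Z" "u \<in> X \<union> Y" using assms(2) by blast
  from strong[OF v u(2)] show "v \<in> Z"
    by (induction rule: converse_rtrancl_induct) (use u assms(1) in auto)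
qed

lemma nonempty: "X \<noteq> {}" "Y \<noteq> {}"
  using card_X card_Y a_ge_2 by auto

lemma ex_out: assumes "v \<in> X \<union> Y" obtains w where "(v, w) \<in> E"
proof -
  have "\<not> (X \<union> Y \<subseteq> {v})" using nonempty disjoint assms by auto
  then have "\<not> E `` {v} \<subseteq> {v}" using closed_out[of "{v}"] assms by auto
  then show ?thesis using that by auto
qed

lemma ex_in: assumes "v \<in> X \<union> Y" obtains w where "(w, v) \<in> E"
proof -
  have "\<not> (X \<union> Y \<subseteq> {v})" using nonempty disjoint assms by auto
  then have "\<not> E\<inverse> `` {v} \<subseteq> {v}" using closed_in[of "{v}"] assms by auto
  then show ?thesis using that by auto
qed

section \<open>Hall's condition and cycle factors\<close>

text \<open>A second in-neighbour of \<open>x\<close> would form a dominating pair with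
  \<open>t\<close>. If \<open>x\<close> itself were in a dominating pair, its in-degree 1 would
  force it to point to all of \<open>Y\<close>. Any other \<open>x'\<close> in \<open>X\<close> then
  shares an out-neighbour with \<open>x\<close>, so \<open>x'\<close> has degree
  \<open>2 * a\<close> and receives arcs from all of \<open>Y\<close>, which puts \<open>t\<close>
  in a dominating pair.\<close>

lemma sole_in_neighbour_not_dom:
  assumes t: "\<And>v. \<not> dom t v" and tx: "(t, x) \<in> E" and x: "x \<in> X"
  shows "E\<inverse> `` {x} = {t}" and "\<not> dom x v"
proof -
  have "u = t" if "(u, x) \<in> E" for u using t[of u] tx that by (auto simp: dom_def)
  then show sole: "E\<inverse> `` {x} = {t}" using tx by blast
  show "\<not> dom x v"
  proof
    assume "dom x v"
    have "card (E `` {x}) \<ge> a" using deg_dom_ge(1)[OF \<open>dom x v\<close>] sole by (simp add: deg_def)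
    then have "card (E `` {x}) = a" using out_le[of x] by simp
    then have full: "E `` {x} = Y"
      using card_subset_eq[OF finite_Y Image_in_Y(1)[of "{x}"]] x card_Y by simp
    have "\<not> X \<subseteq> {x}" using card_mono[of "{x}" X] card_X a_ge_2 by auto
    then obtain x' where x': "x' \<in> X" "x' \<noteq> x" by auto
    obtain z where z: "(x', z) \<in> E" using ex_out x' by blast
    then have "z \<in> Y" using Image_in_Y(1)[of "{x'}"] x' by auto
    then have "(x, z) \<in> E" using full by blast
    then have "deg x + deg x' \<ge> 3 * a + 1" using deg_dom domI[of x x' z] z x' by auto
    moreover have "deg x = a + 1" using full card_Y sole by (simp add: deg_def)
    ultimately have "card (E\<inverse> `` {x'}) = a"
      using out_le[of x'] in_le[of x'] by (simp add: deg_def)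
    then have full': "E\<inverse> `` {x'} = Y"
      using card_subset_eq[OF finite_Y Image_in_Y(2)[of "{x'}"]] x' card_Y by simp
    have "t \<in> Y" using tx x bipartite disjoint by auto
    have "\<not> Y \<subseteq> {t}" using card_mono[of "{t}" Y] card_Y a_ge_2 by auto
    then obtain t' where "t' \<in> Y" "t' \<noteq> t" by auto
    then have "dom t t'" using full' \<open>t \<in> Y\<close> by (intro domI[of _ _ x']) auto
    then show False using t by blast
  qed
qed

text \<open>In a minimal violator \<open>S\<close> two vertices share an out-neighbour, which makes
  \<open>S\<close> large. The vertices of \<open>Y\<close> missed by \<open>S\<close> then have
  small in-degree, and all but at most one are in no dominating pair. These, with
  \<open>X - S\<close>, form a set that no arc enters, against strong connectivity.\<close>

lemma hall_condition:
  assumes "S \<subseteq> X" shows "card S \<le> card (E `` S)"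
proof (rule ccontr)
  assume "\<not> ?thesis"
  then have ex: "\<exists>S. S \<subseteq> X \<and> card (E `` S) < card S" using assms by (auto simp: not_le)
  obtain S where S: "S \<subseteq> X" "card (E `` S) < card S"
    and min: "\<And>S'. S' \<subseteq> X \<Longrightarrow> card (E `` S') < card S' \<Longrightarrow> card S \<le> card S'"
    using ex_has_least_nat[of "\<lambda>S. S \<subseteq> X \<and> card (E `` S) < card S" _ card] ex by (metis (no_types, lifting))
  define T where "T = Y - E `` S"
  have finS: "finite S" using S finite_X finite_subset by blast
  have S_le: "card S \<le> a" using S card_mono[OF finite_X] card_X by auto
  have card_T: "card T = a - card (E `` S)"
    unfolding T_def using card_Y Image_in_Y(1)[OF S(1)] finite_Image by (simp add: card_Diff_subset)
  have "T \<noteq> {}" using card_T S S_le by auto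
  have T_in: "E\<inverse> `` {t} \<subseteq> X - S" if "t \<in> T" for t
    using that Image_in_X(2)[of "{t}"] by (auto simp: T_def)
  have "S \<noteq> X"
  proof
    assume "S = X"
    obtain t where "t \<in> T" using \<open>T \<noteq> {}\<close> by blast
    then show False using T_in[of t] ex_in[of t] \<open>S = X\<close> by (auto simp: T_def)
  qed
  then have S_lt: "card S < a" using S psubset_card_mono[OF finite_X, of S] card_X by auto
  have card_XS: "card (X - S) = a - card S" using S finS card_X by (simp add: card_Diff_subset)
  \<comment> \<open>By pigeonhole some pair in \<open>S\<close> is dominating. Its out-degrees are
    at most \<open>card S - 1\<close> and its in-degrees at most \<open>a\<close>.\<close>
  have S_big: "2 * card S \<ge> a + 3"
  proof -
    have "\<forall>x\<in>S. \<exists>y. (x, y) \<in> E" using S ex_out by blast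
    then obtain f where f: "\<And>x. x \<in> S \<Longrightarrow> (x, f x) \<in> E" by metis
    have "f ` S \<subseteq> E `` S" using f by auto
    then have "\<not> inj_on f S" using card_inj_on_le[of f S "E `` S"] S(2) finite_Image by auto
    then obtain u v where uv: "u \<in> S" "v \<in> S" "u \<noteq> v" "f u = f v" by (auto simp: inj_on_def)
    then have "dom u v" using f by (metis domI)
    moreover have "card (E `` {x}) \<le> card S - 1" if "x \<in> S" for x
      using card_mono[OF finite_Image(1)[of S], of "E `` {x}"] Image_mono[of E E "{x}" S] that S(2) by auto
    from this[of u] this[of v] have "card (E `` {u}) \<le> card S - 1" "card (E `` {v}) \<le> card S - 1"
      using uv by auto
    ultimately show ?thesis using deg_dom[of u v] in_le[of u] in_le[of v] S(2)
      by (simp add: deg_def)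
  qed
  have T_in_le: "card (E\<inverse> `` {t}) \<le> a - card S" if "t \<in> T" for t
    using card_mono[OF _ T_in[OF that]] card_XS finite_X by simp
  \<comment> \<open>The degrees would add up to at most \<open>4 * a - 2 * card S\<close>, hence at
    most \<open>3 * a - 3\<close>.\<close>
  have T_indep: "\<not> dom t t'" if "t \<in> T" "t' \<in> T" for t t'
    using deg_dom[of t t'] T_in_le[OF that(1)] T_in_le[OF that(2)] out_le[of t] out_le[of t'] S_big S_lt
    by (auto simp: deg_def)
  \<comment> \<open>Two such vertices would have disjoint out-neighbourhoods of size at least
    \<open>card S + 1\<close> each inside \<open>X\<close>, but \<open>2 * card S\<close> exceeds
    \<open>a\<close>.\<close>
  have T_dom_unique: "t = t'" if "t \<in> T" "t' \<in> T" "dom t v" "dom t' v'" for t t' v v'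
  proof (rule ccontr)
    assume "t \<noteq> t'"
    then have "E `` {t} \<inter> E `` {t'} = {}" using T_indep[OF that(1,2)] domI by blast
    then have "card (E `` {t}) + card (E `` {t'}) = card (E `` {t} \<union> E `` {t'})"
      using finite_Image by (subst card_Un_disjoint) auto
    also have "\<dots> \<le> card X"
      using that Image_in_X(1)[of "{t}"] Image_in_X(1)[of "{t'}"]
      by (intro card_mono[OF finite_X] Un_least) (auto simp: T_def)
    finally show False
      using deg_dom_ge(1)[OF that(3)] deg_dom_ge(1)[OF that(4)] T_in_le[OF that(1)] T_in_le[OF that(2)]
        S_big S_lt card_X by (simp add: deg_def)
  qed
  define T' where "T' = {t \<in> T. \<forall>v. \<not> dom t v}"
  have "finite T" using finite_Y by (simp add: T_def)
  have card_T': "card T' \<ge> a - card S"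
  proof -
    have "card (T - T') \<le> 1"
      using T_dom_unique \<open>finite T\<close> by (subst One_nat_def, subst card_le_Suc0_iff_eq) (auto simp: T'_def)
    moreover have "card (T - T') = card T - card T'"
      using \<open>finite T\<close> by (intro card_Diff_subset) (auto simp: T'_def)
    ultimately show ?thesis using card_T S S_lt by simp
  qed
  have T': "t \<in> T" "\<not> dom t v" "t \<in> Y" if "t \<in> T'" for t v using that by (auto simp: T'_def T_def)
  have out_T': "x \<in> X - S" "E\<inverse> `` {x} = {t}" if "t \<in> T'" "(t, x) \<in> E" for t x
  proof -
    have x: "x \<in> X" using that T' Image_in_X(1)[of "{t}"] by auto
    show "E\<inverse> `` {x} = {t}" using sole_in_neighbour_not_dom(1)[OF T'(2)[OF that(1)] that(2) x] .
    have nd: "\<not> dom x v" for v using sole_in_neighbour_not_dom(2)[OF T'(2)[OF that(1)] that(2) x] .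
    \<comment> \<open>Otherwise \<open>x\<close>, being in no dominating pair, has an out-neighbour
      that nothing else in \<open>S\<close> reaches, and \<open>S - {x}\<close> is a smaller
      violator.\<close>
    have "x \<notin> S"
    proof
      assume "x \<in> S"
      obtain z where z: "(x, z) \<in> E" using ex_out x by blast
      have "z \<notin> E `` (S - {x})"
      proof
        assume "z \<in> E `` (S - {x})"
        then obtain u where "u \<noteq> x" "(u, z) \<in> E" by auto
        then show False using nd[of u] domI[of x u z] z by auto
      qed
      then have "card (E `` (S - {x})) < card (E `` S)"
        using z \<open>x \<in> S\<close> by (intro psubset_card_mono finite_Image) auto
      then have "card S \<le> card (S - {x})"
        using S \<open>x \<in> S\<close> finS by (intro min) auto
      then show False using \<open>x \<in> S\<close> finS by (metis card_Diff1_less leD)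
    qed
    then show "x \<in> X - S" using x by simp
  qed
  have "\<forall>t\<in>T'. \<exists>x. (t, x) \<in> E" using T' ex_out by blast
  then obtain g where g: "\<And>t. t \<in> T' \<Longrightarrow> (t, g t) \<in> E" by metis
  have "inj_on g T'" using g out_T' by (intro inj_onI) (metis singleton_inject)
  then have "card (g ` T') = card T'" by (rule card_image)
  moreover have sub: "g ` T' \<subseteq> X - S" using g out_T' by auto
  \<comment> \<open>The injective \<open>g\<close> has at least \<open>card (X - S)\<close> values
    in \<open>X - S\<close>, so every vertex of \<open>X - S\<close> has its only in-neighbour in
    \<open>T'\<close>.\<close>
  ultimately have XS: "g ` T' = X - S"
    using card_T' card_XS finite_X by (intro card_seteq) auto
  have "E\<inverse> `` (T' \<union> (X - S)) \<subseteq> T' \<union> (X - S)"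
  proof (intro subsetI)
    fix u assume "u \<in> E\<inverse> `` (T' \<union> (X - S))"
    then obtain v where v: "v \<in> T' \<union> (X - S)" "(u, v) \<in> E" by auto
    show "u \<in> T' \<union> (X - S)"
    proof (cases "v \<in> T'")
      case True
      then show ?thesis using T_in[of v] T'(1) v by auto
    next
      case False
      then obtain t where "t \<in> T'" "v = g t" using v XS by auto
      then have "E\<inverse> `` {v} = {t}" using out_T'(2)[of t v] g by blast
      moreover have "u \<in> E\<inverse> `` {v}" using v(2) by simp
      ultimately show ?thesis using \<open>t \<in> T'\<close> by simp
    qed
  qed
  moreover have "X - S \<noteq> {}" using S \<open>S \<noteq> X\<close> by auto
  ultimately have "X \<subseteq> T' \<union> (X - S)" using closed_in[of "T' \<union> (X - S)"] by blast
  moreover have "S \<noteq> {}" using S_big by auto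
  ultimately show False using S T'(3) disjoint by blast
qed

text \<open>Hall's theorem on each side gives matchings \<open>f\<close> and \<open>g\<close>; glued
  together they are a permutation, extended by the identity as \<open>permutes\<close>
  demands.\<close>

lemma ex_cycle_factor: "\<exists>s. s permutes (X \<union> Y) \<and> (\<forall>v\<in>X \<union> Y. (v, s v) \<in> E)"
proof -
  interpret swap: dominating_degree_digraph Y X E a by (rule swap_sides)
  obtain f where f: "inj_on f X" "\<And>x. x \<in> X \<Longrightarrow> (x, f x) \<in> E"
    using hall_marriage[OF finite_X finite_Image(1) hall_condition] by blast
  obtain g where g: "inj_on g Y" "\<And>y. y \<in> Y \<Longrightarrow> (y, g y) \<in> E"
    using hall_marriage[OF finite_Y finite_Image(1) swap.hall_condition] by blast
  have fY: "f ` X \<subseteq> Y" and gX: "g ` Y \<subseteq> X" using f g bipartite disjoint by blast+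
  define s where "s v = (if v \<in> X then f v else if v \<in> Y then g v else v)" for v
  have sY: "s y = g y" if "y \<in> Y" for y using that disjoint by (auto simp: s_def)
  have "inj_on s X" using f(1) by (simp add: s_def inj_on_def)
  moreover have "inj_on s Y" using g(1) by (simp add: sY inj_on_def)
  moreover have "s ` X \<subseteq> Y" "s ` Y \<subseteq> X" using fY gX sY by (auto simp: s_def)
  ultimately have "inj_on s (X \<union> Y)" using disjoint by (auto simp: inj_on_Un)
  moreover have "s ` (X \<union> Y) \<subseteq> X \<union> Y" using fY gX sY by (auto simp: s_def)
  ultimately have "bij_betw s (X \<union> Y) (X \<union> Y)"
    using finite_X finite_Y by (simp add: bij_betw_def endo_inj_surj)
  then have "s permutes (X \<union> Y)" by (rule bij_imp_permutes) (auto simp: s_def)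
  then show ?thesis using f g by (intro exI[of _ s]) (auto simp: s_def)
qed

end

section \<open>Counting on a short cycle that allows no exchange\<close>

text \<open>Each \<open>c u\<close> occurs in \<open>2 * (card A - 1)\<close> ordered pairs, each
  \<open>k\<close> once per pair.\<close>

lemma sum_pairs:
  fixes c :: "'b \<Rightarrow> int"
  assumes "finite A"
  shows "(\<Sum>v\<in>A. \<Sum>w\<in>A - {v}. c v + c w + k) =
    (int (card A) - 1) * (2 * sum c A + int (card A) * k)"
proof -
  have "(\<Sum>w\<in>A - {v}. c v + c w + k) = (int (card A) - 2) * c v + sum c A + (int (card A) - 1) * k"
    if "v \<in> A" for v
  proof -
    have "card A \<ge> 1" using that assms by (metis One_nat_def Suc_leI card_gt_0_iff empty_iff)
    then show ?thesis using that assms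
      by (simp add: sum.distrib sum_diff1 of_nat_diff algebra_simps)
  qed
  then have "(\<Sum>v\<in>A. \<Sum>w\<in>A - {v}. c v + c w + k) =
      (\<Sum>v\<in>A. (int (card A) - 2) * c v + sum c A + (int (card A) - 1) * k)"
    by (rule sum.cong[OF refl])
  also have "\<dots> = (int (card A) - 1) * (2 * sum c A + int (card A) * k)"
    by (simp add: sum.distrib sum_subtractf sum_distrib_left[symmetric] sum_distrib_right[symmetric] algebra_simps)
  finally show ?thesis .
qed

text \<open>The situation to be refuted: \<open>no_exchange\<close> is what maximality of the factor
  yields, and \<open>C_half\<close> keeps \<open>C\<close> a proper part of the vertices.\<close>

locale split_cycle_factor = dominating_degree_digraph +
  fixes s :: "'a \<Rightarrow> 'a" and C :: "'a set"
  assumes s_permutes: "s permutes X \<union> Y" and s_arc: "v \<in> X \<union> Y \<Longrightarrow> (v, s v) \<in> E"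
    and C_sub: "C \<subseteq> X \<union> Y" and C_nonempty: "C \<noteq> {}" and C_invariant: "s ` C = C"
    and C_half: "card C \<le> a"
    and no_exchange: "v \<in> C \<Longrightarrow> w \<in> X \<union> Y - C \<Longrightarrow> (v, s w) \<in> E \<Longrightarrow> (w, s v) \<notin> E"
begin

lemma swap_split: "split_cycle_factor Y X E a s C"
proof -
  interpret swap: dominating_degree_digraph Y X E a by (rule swap_sides)
  show ?thesis
  proof
    show "s permutes Y \<union> X" "C \<subseteq> Y \<union> X" using s_permutes C_sub by (simp_all add: Un_commute)
    show "(v, s v) \<in> E" if "v \<in> Y \<union> X" for v using s_arc that by blast
    show "(w, s v) \<notin> E" if "v \<in> C" "w \<in> Y \<union> X - C" "(v, s w) \<in> E" for v w
      using no_exchange[of v w] that by blast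
  qed (fact C_nonempty C_invariant C_half)+
qed

lemma s_inj: "inj s"
  using s_permutes by (rule permutes_inj)

lemma s_in: "v \<in> X \<Longrightarrow> s v \<in> Y" "v \<in> Y \<Longrightarrow> s v \<in> X"
  using s_arc[of v] bipartite disjoint by auto

lemma s_image: "s ` X = Y"
proof (rule card_seteq[OF finite_Y])
  show "s ` X \<subseteq> Y" using s_in by auto
  show "card Y \<le> card (s ` X)"
    using card_X card_Y s_inj by (simp add: card_image inj_on_subset)
qed

lemma finite_C: "finite C"
  using C_sub finite_X finite_Y finite_subset by blast

lemma s_image_C: "s ` (C \<inter> X) = C \<inter> Y"
proof -
  have "s ` (C \<inter> X) = s ` C \<inter> s ` X" using s_inj by (rule image_Int)
  then show ?thesis using C_invariant s_image by simp
qed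

lemma card_C_Y: "card (C \<inter> Y) = card (C \<inter> X)"
  using card_image[of s "C \<inter> X"] s_inj s_image_C by (simp add: inj_on_subset)

lemma C_split: "C = (C \<inter> X) \<union> (C \<inter> Y)" "(C \<inter> X) \<inter> (C \<inter> Y) = {}"
  using C_sub disjoint by auto

lemma card_C: "2 * card (C \<inter> X) \<le> a"
proof -
  have "card C = card (C \<inter> X) + card (C \<inter> Y)"
    using C_split finite_C by (metis card_Un_disjoint finite_Int)
  then show ?thesis using C_half card_C_Y by simp
qed

lemma card_C_pos: "card (C \<inter> X) \<ge> 1"
proof (rule ccontr)
  assume none: "\<not> ?thesis"
  then have "C \<inter> X = {}" using finite_C by (simp add: not_le)
  moreover have "C \<inter> Y = {}" using none card_C_Y finite_C by (simp add: not_le)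
  ultimately show False using C_split C_nonempty by simp
qed

text \<open>
  Being in no dominating pair propagates along arcs, hence by strong connectivity to
  every vertex, and then every arc is of the form \<open>(v, s v)\<close>.
\<close>
lemma ex_dom:
  assumes "v \<in> X \<union> Y" shows "\<exists>u. dom v u"
proof (rule ccontr)
  interpret swap: dominating_degree_digraph Y X E a by (rule swap_sides)
  assume v: "\<not> ?thesis"
  define Z where "Z = {v. \<forall>u. \<not> dom v u}"
  have step: "x \<in> Z" "E\<inverse> `` {x} = {t}" if "t \<in> Z" "(t, x) \<in> E" for t x
  proof -
    consider "x \<in> X" | "x \<in> Y" using bipartite \<open>(t, x) \<in> E\<close> by auto
    then have "x \<in> Z \<and> E\<inverse> `` {x} = {t}"
    proof cases
      case 1
      then show ?thesis using that sole_in_neighbour_not_dom[of t x] by (auto simp: Z_def)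
    next
      case 2
      then show ?thesis using that swap.sole_in_neighbour_not_dom[of t x] by (auto simp: Z_def)
    qed
    then show "x \<in> Z" "E\<inverse> `` {x} = {t}" by auto
  qed
  have "X \<union> Y \<subseteq> Z" using closed_out[of Z] step v assms by (auto simp: Z_def)
  moreover have "E `` C \<subseteq> C"
  proof
    fix x assume "x \<in> E `` C"
    then obtain t where t: "t \<in> C" "(t, x) \<in> E" by auto
    have "x \<in> s ` (X \<union> Y)" using t bipartite permutes_image[OF s_permutes] by auto
    then obtain w where w: "w \<in> X \<union> Y" "x = s w" by auto
    have "w = t" using step(2)[of t x] s_arc[OF w(1)] w t C_sub \<open>X \<union> Y \<subseteq> Z\<close> by auto
    then show "x \<in> C" using w t C_invariant by auto
  qed
  then have "X \<union> Y \<subseteq> C" using closed_out[of C] C_sub C_nonempty by blast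
  then have "C \<inter> X = X" by auto
  then show False using card_C card_X a_ge_2 by simp
qed

lemma deg_ge: "v \<in> X \<union> Y \<Longrightarrow> deg v \<ge> a + 1"
  using ex_dom deg_dom_ge by blast

text \<open>For \<open>v\<close> in \<open>X\<close> the two neighbourhoods lie on opposite sides,
  but \<open>s\<close> maps \<open>X\<close> onto \<open>Y\<close>, so both can be indexed by
  vertices \<open>w\<close> of \<open>X\<close>.\<close>

definition F :: "'a \<Rightarrow> nat" where
  "F v = card (E `` {v}) + card (E\<inverse> `` {s v})"

text \<open>The contribution of \<open>w\<close> to \<open>F v\<close>, symmetric in
  \<open>v\<close> and \<open>w\<close>. For distinct vertices the value 2 means that their
  successors can be exchanged.\<close>

definition Q :: "'a \<Rightarrow> 'a \<Rightarrow> int" where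
  "Q v w = of_bool ((v, s w) \<in> E) + of_bool ((w, s v) \<in> E)"

text \<open>Either arc counted by \<open>Q\<close> would give \<open>v\<close> and \<open>w\<close>
  the common out-neighbour \<open>s v\<close> or \<open>s w\<close>.\<close>

lemma Q_le_0:
  assumes "v \<in> X \<union> Y" "w \<in> X \<union> Y" "v \<noteq> w" "\<not> dom v w"
  shows "Q v w \<le> 0"
  using assms s_arc[of v] s_arc[of w] domI[of v w "s v"] domI[of v w "s w"] by (auto simp: Q_def)

lemma F_eq:
  assumes "v \<in> X" shows "int (F v) = (\<Sum>w\<in>X. Q v w)"
proof -
  have "E `` {v} = s ` (X \<inter> {w. (v, s w) \<in> E})"
    using Image_in_Y(1)[of "{v}"] assms s_image by auto
  then have "card (E `` {v}) = card (X \<inter> {w. (v, s w) \<in> E})"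
    using s_inj by (simp add: card_image inj_on_subset)
  moreover have "E\<inverse> `` {s v} = X \<inter> {w. (w, s v) \<in> E}"
    using Image_in_X(2)[of "{s v}"] s_in assms by auto
  ultimately show ?thesis using finite_X by (simp add: F_def Q_def sum.distrib sum_of_bool_eq)
qed

lemma F_le:
  assumes "v \<in> C \<inter> X"
  shows "int (F v) \<le> int a - int (card (C \<inter> X)) + 2 + (\<Sum>w\<in>C \<inter> X - {v}. Q v w)"
proof -
  have "Q v w \<le> 1" if "w \<in> X - C" for w
    using no_exchange[of v w] that assms by (auto simp: Q_def)
  then have "(\<Sum>w\<in>X - C. Q v w) \<le> (\<Sum>w\<in>X - C. 1)" by (intro sum_mono)
  also have "\<dots> = int a - int (card (C \<inter> X))"
    using card_X card_Diff_subset_Int[of X C] finite_C card_mono[OF finite_X, of "C \<inter> X"]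
    by (simp add: Int_commute of_nat_diff)
  finally have 1: "(\<Sum>w\<in>X - C. Q v w) \<le> int a - int (card (C \<inter> X))" .
  have "Q v v = 2" using s_arc assms by (simp add: Q_def)
  then have 2: "(\<Sum>w\<in>C \<inter> X. Q v w) = 2 + (\<Sum>w\<in>C \<inter> X - {v}. Q v w)"
    using assms finite_X by (subst sum.remove[of _ v]) auto
  have "(\<Sum>w\<in>X. Q v w) = (\<Sum>w\<in>C \<inter> X. Q v w) + (\<Sum>w\<in>X - C. Q v w)"
    using finite_X by (subst sum.Int_Diff[of _ _ C]) (auto simp: Int_commute)
  then show ?thesis using F_eq[of v] assms 1 2 by simp
qed

lemma sum_F: "sum F C = sum deg C"
proof -
  have "(\<Sum>v\<in>C. card (E\<inverse> `` {s v})) = (\<Sum>v\<in>s ` C. card (E\<inverse> `` {v}))"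
    using s_inj by (simp add: sum.reindex inj_on_subset)
  then show ?thesis using C_invariant by (simp add: F_def deg_def sum.distrib)
qed

lemma sum_sides:
  fixes h :: "'a \<Rightarrow> nat"
  shows "sum h C = sum h (C \<inter> X) + sum h (C \<inter> Y)"
  using C_split finite_C by (metis finite_Int sum.union_disjoint)

lemma sum_F_less:
  assumes m: "card (C \<inter> X) \<ge> 2" shows "sum F (C \<inter> X) < sum deg (C \<inter> X)"
proof -
  define A where "A = C \<inter> X"
  define m where "m = int (card A)"
  define c where "c v = int (deg v) - int a" for v
  define K where "K = (\<Sum>v\<in>A. \<Sum>w\<in>A - {v}. Q v w)"
  have finA: "finite A" using finite_X by (simp add: A_def)
  have m2: "m \<ge> 2" using m by (simp add: m_def A_def)
  have ma: "2 * m \<le> int a" using card_C by (simp add: m_def A_def)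
  have c1: "c v \<ge> 1" if "v \<in> A" for v using deg_ge[of v] that by (auto simp: c_def A_def)
  \<comment> \<open>The goal is \<open>K < sum c A + m * (m - 2)\<close>. Scaled by
    \<open>2 * (m - 1)\<close> and spread over the \<open>m * (m - 1)\<close> ordered pairs, the
    right side becomes this bound. A dominating pair meets it because
    \<open>2 * m \<le> a\<close>.\<close>
  have pair: "2 * (m - 1) * Q v w < c v + c w + (2 * m - 4)" if "v \<in> A" "w \<in> A - {v}" for v w
  proof (cases "dom v w")
    case True
    have "Q v w \<le> 2" by (simp add: Q_def)
    then have "2 * (m - 1) * Q v w \<le> 2 * (m - 1) * 2" using m2 by (intro mult_left_mono) auto
    moreover have "c v + c w \<ge> int a + 1" using deg_dom[OF True] by (simp add: c_def)
    ultimately show ?thesis using ma by simp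
  next
    case False
    have "Q v w \<le> 0" using that False by (intro Q_le_0) (auto simp: A_def)
    then have "2 * (m - 1) * Q v w \<le> 0" using m2 by (simp add: mult_nonneg_nonpos)
    then show ?thesis using c1[of v] c1[of w] that m2 by auto
  qed
  have ne: "A - {v} \<noteq> {}" for v
    using m card_mono[of "{v}" A] by (auto simp: A_def)
  have "2 * (m - 1) * K = (\<Sum>v\<in>A. \<Sum>w\<in>A - {v}. 2 * (m - 1) * Q v w)"
    by (simp add: K_def sum_distrib_left)
  also have "\<dots> < (\<Sum>v\<in>A. \<Sum>w\<in>A - {v}. c v + c w + (2 * m - 4))"
    using finA ne pair by (intro sum_strict_mono) auto
  also have "\<dots> = (m - 1) * (2 * sum c A + m * (2 * m - 4))"
    using sum_pairs[OF finA] by (simp add: m_def)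
  also have "\<dots> = 2 * (m - 1) * (sum c A + m * (m - 2))" by (simp add: algebra_simps)
  finally have K: "K < sum c A + m * (m - 2)" using m2 by (simp add: mult_less_cancel_left)
  have "int (sum F A) = (\<Sum>v\<in>A. int (F v))" by simp
  also have "\<dots> \<le> (\<Sum>v\<in>A. int a - m + 2 + (\<Sum>w\<in>A - {v}. Q v w))"
    using F_le by (intro sum_mono) (simp add: A_def m_def)
  also have "\<dots> = m * (int a - m + 2) + K"
    by (simp add: sum.distrib sum_subtractf K_def m_def algebra_simps)
  also have "\<dots> < m * int a + sum c A" using K by (simp add: algebra_simps)
  also have "\<dots> = int (sum deg A)" by (simp add: c_def sum_subtractf m_def)
  finally show ?thesis unfolding A_def by linarith
qed

lemma absurd: False
proof -
  interpret swap: split_cycle_factor Y X E a s C by (rule swap_split)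
  show False
  proof (cases "card (C \<inter> X) \<ge> 2")
    case True
    then show False
      \<comment> \<open>Strict inequality on both sides contradicts the equality of the sums over
        \<open>C\<close>.\<close>
      using sum_F_less swap.sum_F_less sum_F card_C_Y by (simp add: sum_sides)
  next
    case False
    then have 1: "card (C \<inter> X) = 1" "card (C \<inter> Y) = 1" using card_C_pos card_C_Y by auto
    obtain x y where x: "C \<inter> X = {x}" and y: "C \<inter> Y = {y}"
      using 1 by (metis card_1_singletonE)
    have xy: "x \<in> X" "y \<in> Y" "y \<in> C" using x y by auto
    have "F x \<le> a + 1" "F y \<le> a + 1" using F_le[of x] swap.F_le[of y] x y by auto
    moreover have "F x + F y = deg x + deg y" using sum_F x y by (simp add: sum_sides)
    moreover have "deg x \<ge> a + 1" "deg y \<ge> a + 1" using deg_ge xy by auto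
    ultimately have deg_xy: "deg x = a + 1" "deg y = a + 1" by auto
    obtain w where w: "dom x w" using ex_dom xy by blast
    then have wX: "w \<in> X" "w \<noteq> x" using bipartite disjoint xy by (auto simp: dom_def)
    \<comment> \<open>As \<open>deg x\<close> is only \<open>a + 1\<close>, the partner
      \<open>w\<close> has degree at least \<open>2 * a\<close>. The same argument applies to
      \<open>y\<close> and \<open>w'\<close> below.\<close>
    have "card (E\<inverse> `` {w}) \<ge> a"
      using deg_dom[OF w] deg_xy out_le[of w] by (simp add: deg_def)
    then have "E\<inverse> `` {w} = Y"
      using wX Image_in_Y(2)[of "{w}"] card_Y by (intro card_seteq finite_Y) auto
    then have yw: "(y, w) \<in> E" using xy by auto
    obtain w' where w': "w' \<in> Y" "s w' = w" using swap.s_image wX by blast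
    have "w' \<noteq> y" using swap.s_image_C x y w' wX by auto
    then have "w' \<notin> C" using w' y by auto
    have "dom y w'" using \<open>w' \<noteq> y\<close> yw s_arc[of w'] w' by (intro domI[of _ _ w]) auto
    then have "card (E `` {w'}) \<ge> a"
      using deg_dom[of y w'] deg_xy in_le[of w'] by (simp add: deg_def)
    then have "E `` {w'} = X"
      using w' Image_in_X(1)[of "{w'}"] card_X by (intro card_seteq finite_X) auto
    \<comment> \<open>With \<open>(y, w)\<close>, where \<open>w = s w'\<close>, this is the
      forbidden exchange of \<open>y\<close> and \<open>w'\<close>.\<close>
    then have "(w', s y) \<in> E" using swap.s_in xy by auto
    then show False using no_exchange[of y w'] yw w' xy \<open>w' \<notin> C\<close> by auto
  qed
qed

end

section \<open>A maximal factor is a single cycle\<close>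

context dominating_degree_digraph
begin

lemma ex_hamiltonian_permutation:
  "\<exists>s. s permutes (X \<union> Y) \<and> (\<forall>v\<in>X \<union> Y. (v, s v) \<in> E \<and> orbit s v = X \<union> Y)"
proof -
  define V where "V = X \<union> Y"
  define factor where "factor s \<longleftrightarrow> s permutes V \<and> (\<forall>v\<in>V. (v, s v) \<in> E)" for s
  \<comment> \<open>The sum of the squared cycle lengths, which grows strictly when two cycles
    merge.\<close>
  define size where "size s = (\<Sum>v\<in>V. card (orbit s v))" for s
  have finV: "finite V" using finite_X finite_Y by (simp add: V_def)
  have cardV: "card V = 2 * a"
    using card_Un_disjoint[OF finite_X finite_Y disjoint] card_X card_Y by (simp add: V_def)
  have orbit_sub: "orbit s v \<subseteq> V" if "factor s" "v \<in> V" for s v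
    using that by (auto simp: factor_def dest!: permutes_orbit_subset)
  obtain s0 where "factor s0" using ex_cycle_factor by (auto simp: factor_def V_def)
  moreover have "size s < Suc (\<Sum>v\<in>V. card V)" if "factor s" for s
    using orbit_sub that unfolding size_def
    by (intro le_imp_less_Suc sum_mono card_mono finV) auto
  ultimately obtain s where s: "factor s" and max: "\<And>t. factor t \<Longrightarrow> size t \<le> size s"
    using ex_has_greatest_nat[of factor s0 size] by (metis less_imp_le_nat)
  have perm: "permutation s" using s finV by (auto simp: factor_def permutation_permutes)
  have self: "v \<in> orbit s v" for v using perm by (rule permutation_self_in_orbit)
  have no_exchange: "(w, s v) \<notin> E"
    if "v \<in> V" "w \<in> V" "w \<notin> orbit s v" "(v, s w) \<in> E" for v w
  proof
    assume wv: "(w, s v) \<in> E"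
    define t where "t = s(v := s w, w := s v)"
    have "t = s \<circ> Transposition.transpose v w" by (auto simp: t_def Transposition.transpose_def fun_eq_iff)
    then have "t permutes V"
      using s that by (auto simp: factor_def intro!: permutes_compose permutes_swap_id)
    then have t: "factor t" using s that wv by (auto simp: factor_def t_def)
    have merge: "orbit s u \<subseteq> orbit t u" "w \<in> orbit t v" for u
      using orbit_merge[OF perm that(3)] by (auto simp: t_def)
    have fin: "finite (orbit t u)" if "u \<in> V" for u
      using orbit_sub[OF t that] finV finite_subset by blast
    have "size s < size t"
      unfolding size_def
    proof (rule sum_strict_mono_ex1[OF finV])
      show "\<forall>u\<in>V. card (orbit s u) \<le> card (orbit t u)" using merge fin by (auto intro: card_mono)
      show "\<exists>u\<in>V. card (orbit s u) < card (orbit t u)"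
        using merge fin that by (intro bexI[of _ v] psubset_card_mono) auto
    qed
    then show False using max[OF t] by simp
  qed
  have "orbit s v = V" if v: "v \<in> V" for v
  proof (rule ccontr)
    assume "orbit s v \<noteq> V"
    then obtain w where w: "w \<in> V" "w \<notin> orbit s v" using orbit_sub[OF s v] by blast
    have orbit_eq: "orbit s y = orbit s x" if "y \<in> orbit s x" for x y
      using that self by (metis orbit_cyclic_eq3 cyclic_on_orbit'[OF perm])
    have "orbit s v \<inter> orbit s w = {}" using orbit_eq w(2) self by blast
    then have "card (orbit s v) + card (orbit s w) \<le> card V"
      using orbit_sub[OF s] v w finV
      by (metis card_Un_disjoint card_mono finite_subset le_sup_iff)
    \<comment> \<open>Two disjoint orbits share \<open>2 * a\<close> vertices, so one has at most
      \<open>a\<close>.\<close>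
    then obtain u where u: "u \<in> V" "card (orbit s u) \<le> a" using v w cardV
      by (metis add_le_mono linorder_le_cases mult_2 le_antisym order_trans nat_add_left_cancel_le)
    interpret split_cycle_factor X Y E a s "orbit s u"
    proof
      show "s permutes X \<union> Y" "\<And>v. v \<in> X \<union> Y \<Longrightarrow> (v, s v) \<in> E"
        using s by (auto simp: factor_def V_def)
      show "orbit s u \<subseteq> X \<union> Y" using orbit_sub[OF s] u by (simp add: V_def)
      show "orbit s u \<noteq> {}" using self by auto
      show "s ` orbit s u = orbit s u"
        using orbit.step[of _ s u] finite_subset[OF orbit_sub[OF s u(1)] finV] s
          inj_on_subset[OF permutes_inj subset_UNIV]
        by (intro endo_inj_surj) (auto simp: factor_def)
      show "card (orbit s u) \<le> a" by (rule u)
      show "(y, s x) \<notin> E" if "x \<in> orbit s u" "y \<in> X \<union> Y - orbit s u" "(x, s y) \<in> E" for x y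
        using no_exchange[of x y] that orbit_eq[of x u] orbit_sub[OF s u(1)] by (auto simp: V_def)
    qed
    show False by (rule absurd)
  qed
  then show ?thesis using s by (intro exI[of _ s]) (auto simp: factor_def V_def)
qed

end

section \<open>From permutations and relations to library digraphs\<close>

lemma (in wf_digraph) hamiltonianI:
  assumes s: "s permutes verts G" and fin: "finite (verts G)" and v: "v \<in> verts G"
    and arcs: "\<And>v. v \<in> verts G \<Longrightarrow> (v, s v) \<in> arcs_ends G" and orbit: "orbit s v = verts G"
  shows "hamiltonian G"
proof -
  have self: "v \<in> orbit s v" using v orbit by simp
  have "\<forall>u\<in>verts G. \<exists>e. e \<in> arcs G \<and> tail G e = u \<and> head G e = s u"
    using arcs by (metis reachableE)
  then obtain e where e: "\<And>u. u \<in> verts G \<Longrightarrow> e u \<in> arcs G \<and> tail G (e u) = u \<and> head G (e u) = s u"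
    by metis
  have funpow_in: "(s ^^ i) v \<in> verts G" for i
    using permutes_in_funpow_image[OF s v] .
  define n where "n = funpow_dist1 s v v"
  define p where "p = map (\<lambda>i. e ((s ^^ i) v)) [0..<n]"
  have "p \<noteq> []" by (simp add: p_def n_def)
  have cas_funpow: "cas v (map (\<lambda>i. e ((s ^^ i) v)) [0..<k]) ((s ^^ k) v)" for k
  proof (induction k)
    case (Suc k)
    then show ?case using awlast_if_cas[OF Suc] by (simp add: cas_append_iff e funpow_in)
  qed simp
  have cas: "cas v p v"
    using cas_funpow[of n] funpow_dist1_prop[OF self] unfolding p_def n_def by metis
  have set_p: "set p \<subseteq> arcs G" using e funpow_in by (auto simp: p_def)
  have awalk: "awalk v p v" using v cas set_p by (simp add: awalk_def)
  have verts: "verts G = (\<lambda>i. (s ^^ i) v) ` {0..<n}"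
    using orbit_conv_funpow_dist1[OF self] orbit by (simp add: n_def)
  have inj: "inj_on (\<lambda>i. (s ^^ i) v) {0..<n}"
    using inj_on_funpow_dist1[OF self] by (simp add: n_def)
  \<comment> \<open>\<open>cycle\<close> asks for distinctness of the tail only, which is the list
    of orbit points shifted once by the injective \<open>s\<close>.\<close>
  have "tl (awalk_verts v p) = map s (map (\<lambda>i. (s ^^ i) v) [0..<n])"
    using awalk_verts_conv'[OF cas] \<open>p \<noteq> []\<close> e funpow_in by (simp add: p_def)
  moreover have "distinct (map s (map (\<lambda>i. (s ^^ i) v) [0..<n]))"
    using inj inj_on_subset[OF permutes_inj[OF s] subset_UNIV] by (auto simp: distinct_map intro: comp_inj_on)
  ultimately have "cycle p"
    using awalk \<open>p \<noteq> []\<close> by (auto simp: cycle_def)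
  moreover have "set (awalk_verts v p) = verts G"
  proof
    show "set (awalk_verts v p) \<subseteq> verts G" using awalk by auto
    show "verts G \<subseteq> set (awalk_verts v p)"
      using verts e funpow_in \<open>p \<noteq> []\<close> by (auto simp: awalk_verts_conv p_def)
  qed
  ultimately show ?thesis unfolding hamiltonian_def by blast
qed

theorem theorem1p6:
  fixes D :: "('a, 'b) pre_digraph" and a :: nat
  assumes "digraph D"
    and "strongly_connected D"
    and "balanced_bipartite D"
    and "card (verts D) = 2 * a"
    and "a \<ge> 2"
    and "\<And>u v. dominating_pair D u v \<Longrightarrow> degree D u + degree D v \<ge> 3 * a + 1"
  shows "hamiltonian D"
proof -
  interpret digraph D by (rule assms(1))
  obtain X Y where XY: "bipartition D X Y" "card X = card Y"
    using assms(3) by (auto simp: balanced_bipartite_def)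
  then have verts: "X \<union> Y = verts D" "X \<inter> Y = {}" by (auto simp: bipartition_def)
  have fin: "finite X" "finite Y" using verts finite_verts by (metis finite_Un)+
  have "card X + card Y = 2 * a"
    using card_Un_disjoint[OF fin verts(2)] verts(1) assms(4) by simp
  then have card: "card X = a" "card Y = a" using XY by auto
  \<comment> \<open>Without parallel arcs, counting arcs at a vertex is counting neighbours.\<close>
  have out: "out_degree D v = card (arcs_ends D `` {v})" for v
  proof -
    have "arcs_ends D `` {v} = head D ` out_arcs D v" by (auto simp: arcs_ends_conv)
    moreover have "inj_on (head D) (out_arcs D v)"
      by (auto simp: inj_on_def arc_to_ends_def intro!: no_multi_arcs)
    ultimately show ?thesis by (simp add: out_degree_def card_image)
  qed
  have in': "in_degree D v = card ((arcs_ends D)\<inverse> `` {v})" for v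
  proof -
    have "(arcs_ends D)\<inverse> `` {v} = tail D ` in_arcs D v" by (auto simp: arcs_ends_conv)
    moreover have "inj_on (tail D) (in_arcs D v)"
      by (auto simp: inj_on_def arc_to_ends_def intro!: no_multi_arcs)
    ultimately show ?thesis by (simp add: in_degree_def card_image)
  qed
  interpret dominating_degree_digraph X Y "arcs_ends D" a
  proof
    show "arcs_ends D \<subseteq> X \<times> Y \<union> Y \<times> X"
      using XY(1) by (auto simp: bipartition_def arcs_ends_conv)
    show "(u, v) \<in> (arcs_ends D)\<^sup>*" if "u \<in> X \<union> Y" "v \<in> X \<union> Y" for u v
      using assms(2) that verts(1) by (auto simp: strongly_connected_def intro: reachable_rtranclI)
    show "card (arcs_ends D `` {u}) + card ((arcs_ends D)\<inverse> `` {u}) +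
        (card (arcs_ends D `` {v}) + card ((arcs_ends D)\<inverse> `` {v})) \<ge> 3 * a + 1"
      if "u \<noteq> v" "u \<rightarrow>\<^bsub>D\<^esub> w" "v \<rightarrow>\<^bsub>D\<^esub> w" for u v w
    proof -
      have "dominating_pair D u v"
        using that adj_in_verts(2)[OF that(2)] by (auto simp: dominating_pair_def)
      from assms(6)[OF this] show ?thesis by (simp add: degree_def out in')
    qed
  qed (fact fin verts(2) card assms(5))+
  obtain s where s: "s permutes verts D" "\<And>v. v \<in> verts D \<Longrightarrow> (v, s v) \<in> arcs_ends D"
      "\<And>v. v \<in> verts D \<Longrightarrow> orbit s v = verts D"
    using ex_hamiltonian_permutation verts(1) by auto
  obtain v where v: "v \<in> verts D" using nonempty verts(1) by blast
  show ?thesis using hamiltonianI[OF s(1) finite_verts v s(2) s(3)[OF v]] .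
qed

end
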